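(* Let $\mathbf E$ be an $n$-dimensional nilpotent evolution algebra of maximal nilindex in the normal form given in the context. Let $\phi\in\mathrm{Aut}(\mathbf E)$ and let $R\in\mathrm{RB}_0(\mathbf E)$ be written with parameters $\beta_i,\lambda$ (and threshold $k$) as in the context. Write $$\phi(\mathbf e_i)=\delta_i\mathbf e_i+\tau_i\mathbf e_n\quad(1\le i<n),\qquad \phi(\mathbf e_n)=\delta_n\mathbf e_n,$$ where $\delta_i=\rho^{2^{i-1}}$ $(1\le i\le n)$, $\tau_1=\gamma$, $\tau_i=0$ $(2\le i<n)$, with $\rho\in\mathbb K^\times$ and $\gamma\in\mathbb K$ the parameters of $\phi$. Then the following hold. (i) If $R$ is annihilator-valued, then $[R,\phi]=0$ if and only if $$\beta_i(\delta_i-\delta_n)+\tau_i\lambda=0\qquad(1\le i<n).$$ (ii) If $R$ has nonzero threshold $k<n$, then $[R,\phi]=0$ if and only if $$\beta_i(\delta_i-\delta_n)+\tau_i\lambda=0\qquad(1\le i<k)$$ and $$\beta_k(\delta_k-\delta_n)+(1-2^{n-k})\tau_k\lambda=0.$$ There are no further conditions for $k<i<n$. In particular, these equations determine a coefficient $\beta_i$ only when the corresponding factor $\delta_i-\delta_n$ is nonzero. If $\delta_i=\delta_n$, the same equation becomes a compatibility condition on the sink term (namely that the term in it involving $\tau_i\lambda$ vanishes) and leaves $\beta_i$ free whenever that compatibility condition is satisfied.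
   Context: $\mathbb K$ is a field of characteristic zero and $n\ge 3$. An evolution algebra is an algebra with a basis $\{\mathbf e_1,\dots,\mathbf e_n\}$ (a natural basis) such that $\mathbf e_i\mathbf e_j=0$ for $i\ne j$. Every $n$-dimensional nilpotent evolution algebra of maximal nilindex over $\mathbb K$ admits a natural basis with $$\mathbf e_i^2=\mathbf e_{i+1}+\sum_{j=i+2}^{n-1}a_{ij}\mathbf e_j\ (1\le i\le n-3),\quad \mathbf e_{n-2}^2=\mathbf e_{n-1},\quad \mathbf e_{n-1}^2=\mathbf e_n,\quad \mathbf e_n^2=0,$$ with $a_{ij}\in\mathbb K$; $\mathbf E$ denotes such an algebra with this fixed basis (the normal form). Put $\mathcal I_A=\{(i,j): i+1<j<n,\ a_{ij}\ne0\}$, and define $i_0=0$ if $\mathcal I_A=\varnothing$, and $i_0=\max\{i:(i,j)\in\mathcal I_A\text{ for some }j\}$ otherwise. $\mathrm{RB}_0(\mathbf E)$ is the set of linear maps $R:\mathbf E\to\mathbf E$ with $R(x)R(y)=R(R(x)y+xR(y))$ for all $x,y\in\mathbf E$. Known classification: $R\in\mathrm{RB}_0(\mathbf E)$ if and only if exactly one of the following holds. (i) Annihilator-valued case: there are $\beta_1,\dots,\beta_{n-1},\lambda\in\mathbb K$ with $R(\mathbf e_i)=\beta_i\mathbf e_n$ $(1\le i<n)$ and $R(\mathbf e_n)=\lambda\mathbf e_n$. (ii) Nonzero threshold case: there are $k\in\{i_0+1,\dots,n-1\}$ (the threshold), $\lambda\in\mathbb K\setminus\{0\}$ and $\beta_1,\dots,\beta_k\in\mathbb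 K$ with $R(\mathbf e_i)=\beta_i\mathbf e_n$ for $1\le i<k$, $R(\mathbf e_k)=2^{n-k}\lambda\mathbf e_k+\beta_k\mathbf e_n$, and $R(\mathbf e_i)=2^{n-i}\lambda\mathbf e_i$ for $k<i\le n$. $\mathrm{Aut}(\mathbf E)$ is the group of algebra automorphisms. Known: every $\phi\in\mathrm{Aut}(\mathbf E)$ has the form $\phi(\mathbf e_1)=\rho\mathbf e_1+\gamma\mathbf e_n$, $\phi(\mathbf e_i)=\rho^{2^{i-1}}\mathbf e_i$ $(2\le i\le n)$ for some $\rho\in\mathbb K^\times=\mathbb K\setminus\{0\}$ and $\gamma\in\mathbb K$; if $\mathcal I_A\ne\varnothing$, then moreover $\rho^\eta=1$ with $\eta=\gcd\{2^{j-1}-2^i:(i,j)\in\mathcal I_A\}$. The $\tau_i$ are called the sink terms. The commutator is $[S,T]=ST-TS$. *)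

theory Defs
  imports Complex_Main
begin

text \<open>
  An algebra over a field is given by a scalar multiplication \<open>scale\<close> on the type \<open>'v\<close> and a
  bilinear, not necessarily associative product \<open>mul\<close>; its underlying space is all of \<open>'v\<close>.
\<close>

definition is_algebra :: "('k::field \<Rightarrow> 'v::ab_group_add \<Rightarrow> 'v) \<Rightarrow> ('v \<Rightarrow> 'v \<Rightarrow> 'v) \<Rightarrow> bool" where
  "is_algebra scale mul \<longleftrightarrow>
     vector_space scale \<and>
     (\<forall>x. Vector_Spaces.linear scale scale (\<lambda>y. mul x y)) \<and>
     (\<forall>y. Vector_Spaces.linear scale scale (\<lambda>x. mul x y))"

text \<open>Bases are indexed by \<open>{1..n}\<close>; the values of \<open>e\<close> outside this range are irrelevant.\<close>

definition natural_basis ::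
  "('k::field \<Rightarrow> 'v::ab_group_add \<Rightarrow> 'v) \<Rightarrow> ('v \<Rightarrow> 'v \<Rightarrow> 'v) \<Rightarrow> nat \<Rightarrow> (nat \<Rightarrow> 'v) \<Rightarrow> bool" where
  "natural_basis scale mul n e \<longleftrightarrow>
     inj_on e {1..n} \<and>
     \<not> module.dependent scale (e ` {1..n}) \<and>
     module.span scale (e ` {1..n}) = UNIV \<and>
     (\<forall>i\<in>{1..n}. \<forall>j\<in>{1..n}. i \<noteq> j \<longrightarrow> mul (e i) (e j) = 0)"

definition evolution_algebra ::
  "('k::field \<Rightarrow> 'v::ab_group_add \<Rightarrow> 'v) \<Rightarrow> ('v \<Rightarrow> 'v \<Rightarrow> 'v) \<Rightarrow> nat \<Rightarrow> bool" where
  "evolution_algebra scale mul n \<longleftrightarrow>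
     is_algebra scale mul \<and> (\<exists>e. natural_basis scale mul n e)"

text \<open>
  The powers \<open>E\<^sup>1 = E\<close> and \<open>E\<^sup>k = \<Sum>\<^sub>i E\<^sup>i E\<^sup>k\<^sup>-\<^sup>i\<close> with \<open>1 \<le> i < k\<close>, where \<open>E\<^sup>i E\<^sup>j\<close> is the span of
  the products. The value at \<open>k = 0\<close> is a dummy and is never used.
\<close>

function alg_power ::
  "('k::field \<Rightarrow> 'v::ab_group_add \<Rightarrow> 'v) \<Rightarrow> ('v \<Rightarrow> 'v \<Rightarrow> 'v) \<Rightarrow> nat \<Rightarrow> 'v set" where
  "alg_power scale mul k =
     (if k \<le> 1 then UNIV
      else module.span scale
        (\<Union>i\<in>{1..<k}. (\<lambda>(x, y). mul x y) ` (alg_power scale mul i \<times> alg_power scale mul (k - i))))"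
  by pat_completeness auto
termination by (relation "measure (\<lambda>(_, _, k). k)") auto

declare alg_power.simps [simp del]

definition nilpotent_algebra ::
  "('k::field \<Rightarrow> 'v::ab_group_add \<Rightarrow> 'v) \<Rightarrow> ('v \<Rightarrow> 'v \<Rightarrow> 'v) \<Rightarrow> bool" where
  "nilpotent_algebra scale mul \<longleftrightarrow> (\<exists>k\<ge>1. alg_power scale mul k = {0})"

definition nilindex ::
  "('k::field \<Rightarrow> 'v::ab_group_add \<Rightarrow> 'v) \<Rightarrow> ('v \<Rightarrow> 'v \<Rightarrow> 'v) \<Rightarrow> nat" where
  "nilindex scale mul = (LEAST k. k \<ge> 1 \<and> alg_power scale mul k = {0})"

text \<open>
  Maximality is among all \<open>n\<close>-dimensional nilpotent evolution algebras over the same field. It is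
  enough to vary the product on the given \<open>n\<close>-dimensional space, since every such algebra is
  isomorphic to one on this space. (The maximum is \<open>2\<^sup>n\<^sup>-\<^sup>1 + 1\<close>.)
\<close>

definition maximal_nilindex ::
  "('k::field \<Rightarrow> 'v::ab_group_add \<Rightarrow> 'v) \<Rightarrow> ('v \<Rightarrow> 'v \<Rightarrow> 'v) \<Rightarrow> nat \<Rightarrow> bool" where
  "maximal_nilindex scale mul n \<longleftrightarrow>
     (\<forall>mul'. evolution_algebra scale mul' n \<and> nilpotent_algebra scale mul' \<longrightarrow>
        nilindex scale mul' \<le> nilindex scale mul)"

definition normal_form ::
  "('k::field \<Rightarrow> 'v::ab_group_add \<Rightarrow> 'v) \<Rightarrow> ('v \<Rightarrow> 'v \<Rightarrow> 'v) \<Rightarrow> nat \<Rightarrow>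
     (nat \<Rightarrow> nat \<Rightarrow> 'k) \<Rightarrow> (nat \<Rightarrow> 'v) \<Rightarrow> bool" where
  "normal_form scale mul n a e \<longleftrightarrow>
     natural_basis scale mul n e \<and>
     (\<forall>i\<in>{1..n - 3}. mul (e i) (e i) = e (i + 1) + (\<Sum>j = i + 2..n - 1. scale (a i j) (e j))) \<and>
     mul (e (n - 2)) (e (n - 2)) = e (n - 1) \<and>
     mul (e (n - 1)) (e (n - 1)) = e n \<and>
     mul (e n) (e n) = 0"

definition nz_index_set :: "nat \<Rightarrow> (nat \<Rightarrow> nat \<Rightarrow> 'k::zero) \<Rightarrow> (nat \<times> nat) set" where
  "nz_index_set n a = {(i, j). 1 \<le> i \<and> i + 1 < j \<and> j < n \<and> a i j \<noteq> 0}"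

definition i_zero :: "nat \<Rightarrow> (nat \<Rightarrow> nat \<Rightarrow> 'k::zero) \<Rightarrow> nat" where
  "i_zero n a =
     (if nz_index_set n a = {} then 0 else Max {i. \<exists>j. (i, j) \<in> nz_index_set n a})"

definition RB0 ::
  "('k::field \<Rightarrow> 'v::ab_group_add \<Rightarrow> 'v) \<Rightarrow> ('v \<Rightarrow> 'v \<Rightarrow> 'v) \<Rightarrow> ('v \<Rightarrow> 'v) set" where
  "RB0 scale mul =
     {R. Vector_Spaces.linear scale scale R \<and>
         (\<forall>x y. mul (R x) (R y) = R (mul (R x) y + mul x (R y)))}"

definition algebra_Aut ::
  "('k::field \<Rightarrow> 'v::ab_group_add \<Rightarrow> 'v) \<Rightarrow> ('v \<Rightarrow> 'v \<Rightarrow> 'v) \<Rightarrow> ('v \<Rightarrow> 'v) set" where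
  "algebra_Aut scale mul =
     {\<phi>. Vector_Spaces.linear scale scale \<phi> \<and> bij \<phi> \<and> (\<forall>x y. \<phi> (mul x y) = mul (\<phi> x) (\<phi> y))}"

definition annihilator_valued ::
  "('k::field \<Rightarrow> 'v::ab_group_add \<Rightarrow> 'v) \<Rightarrow> nat \<Rightarrow> (nat \<Rightarrow> 'v) \<Rightarrow>
     ('v \<Rightarrow> 'v) \<Rightarrow> (nat \<Rightarrow> 'k) \<Rightarrow> 'k \<Rightarrow> bool" where
  "annihilator_valued scale n e R \<beta> l \<longleftrightarrow>
     (\<forall>i\<in>{1..<n}. R (e i) = scale (\<beta> i) (e n)) \<and> R (e n) = scale l (e n)"

definition nonzero_threshold ::
  "('k::field \<Rightarrow> 'v::ab_group_add \<Rightarrow> 'v) \<Rightarrow> nat \<Rightarrow> (nat \<Rightarrow> nat \<Rightarrow> 'k) \<Rightarrow> (nat \<Rightarrow> 'v) \<Rightarrow>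
     ('v \<Rightarrow> 'v) \<Rightarrow> nat \<Rightarrow> (nat \<Rightarrow> 'k) \<Rightarrow> 'k \<Rightarrow> bool" where
  "nonzero_threshold scale n a e R k \<beta> l \<longleftrightarrow>
     k \<in> {i_zero n a + 1..n - 1} \<and> l \<noteq> 0 \<and>
     (\<forall>i\<in>{1..<k}. R (e i) = scale (\<beta> i) (e n)) \<and>
     R (e k) = scale (2 ^ (n - k) * l) (e k) + scale (\<beta> k) (e n) \<and>
     (\<forall>i\<in>{k<..n}. R (e i) = scale (2 ^ (n - i) * l) (e i))"

definition commutator :: "('v \<Rightarrow> 'v) \<Rightarrow> ('v \<Rightarrow> 'v) \<Rightarrow> 'v \<Rightarrow> 'v::ab_group_add" where
  "commutator S T = (\<lambda>x. S (T x) - T (S x))"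

end

theory Submission
  imports Defs
begin

text \<open>
  In both families of the classification, every basis vector \<open>e\<^sub>i\<close> is an eigenvector of \<open>R\<close> up to a
  multiple of the last basis vector \<open>e\<^sub>n\<close>, which is itself an eigenvector: \<open>R e\<^sub>i = \<mu>\<^sub>i e\<^sub>i + b\<^sub>i e\<^sub>n\<close> and
  \<open>R e\<^sub>n = l e\<^sub>n\<close>. The automorphism has the same shape, \<open>\<phi> e\<^sub>i = \<delta>\<^sub>i e\<^sub>i + \<tau>\<^sub>i e\<^sub>n\<close> and \<open>\<phi> e\<^sub>n = \<delta>\<^sub>n e\<^sub>n\<close>.
  For two maps of this shape the diagonal parts commute, so only the last coordinate of the
  commutator survives:
  \<open>[R, \<phi>] e\<^sub>i = (b\<^sub>i (\<delta>\<^sub>i - \<delta>\<^sub>n) + \<tau>\<^sub>i (l - \<mu>\<^sub>i)) e\<^sub>n\<close> (lemma \<open>commutator_diagonal_plus_sink\<close>).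
  A linear map vanishes iff it vanishes on a basis, and \<open>e\<^sub>n \<noteq> 0\<close>, so the maps commute iff these scalars
  vanish for all \<open>i < n\<close> (lemma \<open>commutator_zero_iff_sink_equations\<close>).

  It remains to read off \<open>\<mu>\<close>. In the annihilator-valued case \<open>\<mu> = 0\<close>. With threshold \<open>k\<close>, \<open>\<mu>\<^sub>i = 0\<close> below
  \<open>k\<close>, and \<open>\<mu>\<^sub>i = 2\<^sup>n\<^sup>-\<^sup>i l\<close> from \<open>k\<close> on; this produces the factor \<open>1 - 2\<^sup>n\<^sup>-\<^sup>k\<close> at \<open>i = k\<close>. Above \<open>k\<close> the
  equation is trivial because \<open>b\<^sub>i = 0\<close> and because \<open>i > k \<ge> 1\<close> forces \<open>\<tau>\<^sub>i = 0\<close>.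

  The statements on when an equation determines \<open>\<beta>\<^sub>i\<close> concern a single affine equation
  \<open>b d + c = 0\<close> over a field (lemma \<open>affine_unique_solution_iff\<close>).
\<close>

text \<open>
  If \<open>d = 0\<close>, then either no \<open>b\<close> or every \<open>b\<close> is a solution, and a field has at least the two
  elements \<open>0\<close> and \<open>1\<close>.
\<close>

lemma affine_unique_solution_iff:
  fixes c d :: "'k::field"
  shows "(\<exists>!b. b * d + c = 0) \<longleftrightarrow> d \<noteq> 0"
proof
  assume "\<exists>!b. b * d + c = 0"
  then show "d \<noteq> 0"
    by (metis mult_zero_right zero_neq_one)
next
  assume "d \<noteq> 0"
  then show "\<exists>!b. b * d + c = 0"
    by (intro ex1I[of _ "- c / d"]) (auto simp: field_simps add_eq_0_iff)
qed

lemma (in vector_space) linear_commutator: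
  assumes "Vector_Spaces.linear scale scale S" and "Vector_Spaces.linear scale scale T"
  shows "Vector_Spaces.linear scale scale (commutator S T)"
proof -
  interpret vector_space_pair scale scale ..
  show ?thesis
    using linear_compose_sub[OF Vector_Spaces.linear_compose[OF assms(2,1)]
        Vector_Spaces.linear_compose[OF assms]]
    by (simp add: commutator_def o_def)
qed

lemma (in vector_space) linear_eq_zero_iff_on_spanning_set:
  assumes f: "Vector_Spaces.linear scale scale f" and B: "span B = UNIV"
  shows "f = (\<lambda>x. 0) \<longleftrightarrow> (\<forall>x\<in>B. f x = 0)"
proof -
  interpret vector_space_pair scale scale ..
  show ?thesis
    using linear_eq_0_on_span[OF f] B by (metis UNIV_I)
qed

text \<open>
  The multiples of \<open>u\<close> in \<open>R (\<phi> u)\<close> and \<open>\<phi> (R u)\<close> have the same factor \<open>m * d\<close> and cancel. What is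
  left lies in the span of \<open>v\<close>, which both maps preserve.
\<close>

lemma (in vector_space) commutator_diagonal_plus_sink:
  assumes R: "Vector_Spaces.linear scale scale R" and \<phi>: "Vector_Spaces.linear scale scale \<phi>"
    and Ru: "R u = scale m u + scale b v" and Rv: "R v = scale l v"
    and \<phi>u: "\<phi> u = scale d u + scale t v" and \<phi>v: "\<phi> v = scale d' v"
  shows "commutator R \<phi> u = scale (b * (d - d') + t * (l - m)) v"
proof -
  interpret R: Vector_Spaces.linear scale scale R by (rule R)
  interpret \<phi>: Vector_Spaces.linear scale scale \<phi> by (rule \<phi>)
  have "R (\<phi> u) = scale (d * m) u + scale (d * b + t * l) v"
    by (simp add: Ru Rv \<phi>u R.add R.scale scale_right_distrib scale_left_distrib add.assoc)
  moreover have "\<phi> (R u) = scale (d * m) u + scale (m * t + b * d') v"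
    by (simp add: Ru \<phi>u \<phi>v \<phi>.add \<phi>.scale scale_right_distrib scale_left_distrib add.assoc
        mult.commute)
  ultimately have "commutator R \<phi> u = scale ((d * b + t * l) - (m * t + b * d')) v"
    by (simp add: commutator_def scale_left_diff_distrib)
  also have "(d * b + t * l) - (m * t + b * d') = b * (d - d') + t * (l - m)"
    by (simp add: algebra_simps)
  finally show ?thesis .
qed

lemma (in vector_space) commutator_zero_iff_sink_equations:
  fixes e :: "nat \<Rightarrow> 'b"
  assumes R: "Vector_Spaces.linear scale scale R" and \<phi>: "Vector_Spaces.linear scale scale \<phi>"
    and span: "span (e ` {1..n}) = UNIV" and en: "e n \<noteq> 0" and n: "n \<ge> 1"
    and Re: "\<And>i. i \<in> {1..<n} \<Longrightarrow> R (e i) = scale (m i) (e i) + scale (b i) (e n)"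
    and Rn: "R (e n) = scale l (e n)"
    and \<phi>e: "\<And>i. i \<in> {1..<n} \<Longrightarrow> \<phi> (e i) = scale (d i) (e i) + scale (t i) (e n)"
    and \<phi>n: "\<phi> (e n) = scale (d n) (e n)"
  shows "commutator R \<phi> = (\<lambda>x. 0) \<longleftrightarrow>
    (\<forall>i\<in>{1..<n}. b i * (d i - d n) + t i * (l - m i) = 0)"
proof -
  have split: "{1..n} = insert n {1..<n}"
    using n by auto
  have "commutator R \<phi> (e n) = 0"
    using commutator_diagonal_plus_sink[OF R \<phi>, of "e n" l 0 "e n" l "d n" 0 "d n"] Rn \<phi>n
    by simp
  then have "commutator R \<phi> = (\<lambda>x. 0) \<longleftrightarrow> (\<forall>i\<in>{1..<n}. commutator R \<phi> (e i) = 0)"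
    unfolding linear_eq_zero_iff_on_spanning_set[OF linear_commutator[OF R \<phi>] span] split
    by simp
  also have "\<dots> \<longleftrightarrow> (\<forall>i\<in>{1..<n}. b i * (d i - d n) + t i * (l - m i) = 0)"
    using commutator_diagonal_plus_sink[OF R \<phi> Re Rn \<phi>e \<phi>n] en
    by (simp add: scale_eq_0_iff)
  finally show ?thesis .
qed

theorem theorem6p4:
  fixes scale :: "'k::field_char_0 \<Rightarrow> 'v::ab_group_add \<Rightarrow> 'v"
    and mul :: "'v \<Rightarrow> 'v \<Rightarrow> 'v"
    and n :: nat
    and a :: "nat \<Rightarrow> nat \<Rightarrow> 'k"
    and e :: "nat \<Rightarrow> 'v"
    and \<phi> R :: "'v \<Rightarrow> 'v"
    and \<rho> \<gamma> :: 'k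
    and \<delta> \<tau> :: "nat \<Rightarrow> 'k"
  assumes "n \<ge> 3"
    and "evolution_algebra scale mul n"
    and "nilpotent_algebra scale mul"
    and "maximal_nilindex scale mul n"
    and "normal_form scale mul n a e"
    and "\<phi> \<in> algebra_Aut scale mul"
    and "R \<in> RB0 scale mul"
    and "\<rho> \<noteq> 0"
    and "\<forall>i\<in>{1..n}. \<delta> i = \<rho> ^ (2 ^ (i - 1))"
    and "\<tau> 1 = \<gamma>"
    and "\<forall>i\<in>{2..<n}. \<tau> i = 0"
    and "\<forall>i\<in>{1..<n}. \<phi> (e i) = scale (\<delta> i) (e i) + scale (\<tau> i) (e n)"
    and "\<phi> (e n) = scale (\<delta> n) (e n)"
  shows
    "(\<forall>\<beta> l. annihilator_valued scale n e R \<beta> l \<longrightarrow>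
        (commutator R \<phi> = (\<lambda>x. 0) \<longleftrightarrow>
           (\<forall>i\<in>{1..<n}. \<beta> i * (\<delta> i - \<delta> n) + \<tau> i * l = 0)) \<and>
        (\<forall>i\<in>{1..<n}.
           ((\<exists>!b. b * (\<delta> i - \<delta> n) + \<tau> i * l = 0) \<longleftrightarrow> \<delta> i - \<delta> n \<noteq> 0) \<and>
           (\<delta> i = \<delta> n \<longrightarrow>
              (\<forall>b. b * (\<delta> i - \<delta> n) + \<tau> i * l = 0 \<longleftrightarrow> \<tau> i * l = 0)))) \<and>
     (\<forall>k \<beta> l. nonzero_threshold scale n a e R k \<beta> l \<longrightarrow>
        (commutator R \<phi> = (\<lambda>x. 0) \<longleftrightarrow>
           (\<forall>i\<in>{1..<k}. \<beta> i * (\<delta> i - \<delta> n) + \<tau> i * l = 0) \<and>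
           \<beta> k * (\<delta> k - \<delta> n) + (1 - 2 ^ (n - k)) * \<tau> k * l = 0) \<and>
        (\<forall>i\<in>{1..<k}.
           ((\<exists>!b. b * (\<delta> i - \<delta> n) + \<tau> i * l = 0) \<longleftrightarrow> \<delta> i - \<delta> n \<noteq> 0) \<and>
           (\<delta> i = \<delta> n \<longrightarrow>
              (\<forall>b. b * (\<delta> i - \<delta> n) + \<tau> i * l = 0 \<longleftrightarrow> \<tau> i * l = 0))) \<and>
        ((\<exists>!b. b * (\<delta> k - \<delta> n) + (1 - 2 ^ (n - k)) * \<tau> k * l = 0) \<longleftrightarrow> \<delta> k - \<delta> n \<noteq> 0) \<and>
        (\<delta> k = \<delta> n \<longrightarrow>
           (\<forall>b. b * (\<delta> k - \<delta> n) + (1 - 2 ^ (n - k)) * \<tau> k * l = 0 \<longleftrightarrow>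
                (1 - 2 ^ (n - k)) * \<tau> k * l = 0)))"
proof -
  have n: "n \<ge> 1"
    using assms(1) by simp
  interpret vector_space scale
    using assms(2) by (simp add: evolution_algebra_def is_algebra_def)
  have span: "span (e ` {1..n}) = UNIV" and indep: "\<not> dependent (e ` {1..n})"
    using assms(5) by (simp_all add: normal_form_def natural_basis_def)
  have en: "e n \<noteq> 0"
    using indep n dependent_zero[of "e ` {1..n}"] by force
  have R: "Vector_Spaces.linear scale scale R" and \<phi>: "Vector_Spaces.linear scale scale \<phi>"
    using assms(6,7) by (simp_all add: RB0_def algebra_Aut_def)
  have criterion: "commutator R \<phi> = (\<lambda>x. 0) \<longleftrightarrow>
      (\<forall>i\<in>{1..<n}. b i * (\<delta> i - \<delta> n) + \<tau> i * (l - m i) = 0)"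
    if "\<And>i. i \<in> {1..<n} \<Longrightarrow> R (e i) = scale (m i) (e i) + scale (b i) (e n)"
      and "R (e n) = scale l (e n)" for m b l
    using commutator_zero_iff_sink_equations[OF R \<phi> span en n that, of \<delta> \<tau>] assms(12,13)
    by blast
  have annihilator_case: "commutator R \<phi> = (\<lambda>x. 0) \<longleftrightarrow>
      (\<forall>i\<in>{1..<n}. \<beta> i * (\<delta> i - \<delta> n) + \<tau> i * l = 0)"
    if "annihilator_valued scale n e R \<beta> l" for \<beta> l
    using criterion[of "\<lambda>i. 0" \<beta> l] that by (simp add: annihilator_valued_def)
  have threshold_case: "commutator R \<phi> = (\<lambda>x. 0) \<longleftrightarrow>
      (\<forall>i\<in>{1..<k}. \<beta> i * (\<delta> i - \<delta> n) + \<tau> i * l = 0) \<and>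
      \<beta> k * (\<delta> k - \<delta> n) + (1 - 2 ^ (n - k)) * \<tau> k * l = 0"
    if "nonzero_threshold scale n a e R k \<beta> l" for k \<beta> l
  proof -
    have k: "1 \<le> k" "k < n"
      and below: "\<And>i. i \<in> {1..<k} \<Longrightarrow> R (e i) = scale (\<beta> i) (e n)"
      and at: "R (e k) = scale (2 ^ (n - k) * l) (e k) + scale (\<beta> k) (e n)"
      and above: "\<And>i. i \<in> {k<..n} \<Longrightarrow> R (e i) = scale (2 ^ (n - i) * l) (e i)"
      using that n by (auto simp: nonzero_threshold_def)
    define m where "m i = (if i < k then 0 else 2 ^ (n - i) * l)" for i
    define b where "b i = (if i \<le> k then \<beta> i else 0)" for i
    let ?eq = "\<lambda>i. b i * (\<delta> i - \<delta> n) + \<tau> i * (l - m i) = 0"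
    have "R (e i) = scale (m i) (e i) + scale (b i) (e n)" if "i \<in> {1..<n}" for i
      using that below[of i] at above[of i]
      by (cases i k rule: linorder_cases) (simp_all add: m_def b_def)
    moreover have "R (e n) = scale l (e n)"
      using above[of n] k by simp
    ultimately have "commutator R \<phi> = (\<lambda>x. 0) \<longleftrightarrow> (\<forall>i\<in>{1..<n}. ?eq i)"
      by (rule criterion)
    also have "{1..<n} = {1..<k} \<union> {k} \<union> {k<..<n}"
      using k by auto
    also have "(\<forall>i\<in>{1..<k} \<union> {k} \<union> {k<..<n}. ?eq i) \<longleftrightarrow> (\<forall>i\<in>{1..<k}. ?eq i) \<and> ?eq k"
      using assms(11) k by (auto simp: b_def)
    also have "(\<forall>i\<in>{1..<k}. ?eq i) \<longleftrightarrow> (\<forall>i\<in>{1..<k}. \<beta> i * (\<delta> i - \<delta> n) + \<tau> i * l = 0)"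
      by (simp add: m_def b_def)
    also have "?eq k \<longleftrightarrow> \<beta> k * (\<delta> k - \<delta> n) + (1 - 2 ^ (n - k)) * \<tau> k * l = 0"
      by (simp add: m_def b_def algebra_simps)
    finally show ?thesis .
  qed
  show ?thesis
    using annihilator_case threshold_case by (simp add: affine_unique_solution_iff)
qed

end
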